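(* For every integer $n>3$, there exists an anti-knight Latin square of order $n$.
   Context: A Latin square of order $n$ is an $n\times n$ table filled with the integers $1,\dots,n$ so that each integer appears exactly once in each row and in each column. An anti-knight Latin square is a Latin square in which any two cells separated by a chess knight's move (row and column indices differing by $1$ and $2$ in absolute value, in some order; no wrap-around) contain different numbers. *)

theory Defs
  imports Main
begin

text \<open>An \<open>n \<times> n\<close> table is a function of the row and column indices, both ranging over
  \<open>{1..n}\<close>; its values at other indices are irrelevant.\<close>

definition latin_square :: "nat \<Rightarrow> (nat \<Rightarrow> nat \<Rightarrow> nat) \<Rightarrow> bool" where
  "latin_square n L \<longleftrightarrow>
     (\<forall>i\<in>{1..n}. \<forall>j\<in>{1..n}. L i j \<in> {1..n}) \<and>
     (\<forall>i\<in>{1..n}. \<forall>k\<in>{1..n}. \<exists>!j. j \<in> {1..n} \<and> L i j = k) \<and>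
     (\<forall>j\<in>{1..n}. \<forall>k\<in>{1..n}. \<exists>!i. i \<in> {1..n} \<and> L i j = k)"

text \<open>The differences are taken in \<open>int\<close>, since subtraction on \<open>nat\<close> truncates.\<close>

definition knight_move :: "nat \<times> nat \<Rightarrow> nat \<times> nat \<Rightarrow> bool" where
  "knight_move = (\<lambda>(i, j) (i', j').
     (\<bar>int i - int i'\<bar> = 1 \<and> \<bar>int j - int j'\<bar> = 2) \<or>
     (\<bar>int i - int i'\<bar> = 2 \<and> \<bar>int j - int j'\<bar> = 1))"

definition anti_knight_latin_square :: "nat \<Rightarrow> (nat \<Rightarrow> nat \<Rightarrow> nat) \<Rightarrow> bool" where
  "anti_knight_latin_square n L \<longleftrightarrow>
     latin_square n L \<and>
     (\<forall>i\<in>{1..n}. \<forall>j\<in>{1..n}. \<forall>i'\<in>{1..n}. \<forall>j'\<in>{1..n}.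
        knight_move (i, j) (i', j') \<longrightarrow> L i j \<noteq> L i' j')"

end

theory Submission
  imports Defs
begin

text \<open>The cyclic table \<open>i + j mod n\<close> works: a knight's move changes \<open>i + j\<close> by
  \<open>\<plusminus>1\<close> or \<open>\<plusminus>3\<close>, neither of which is divisible by \<open>n > 3\<close>.\<close>

text \<open>Congruent numbers differ by a multiple of \<open>n\<close>, and 0 is the only multiple
  of absolute value below \<open>n\<close>. This serves both the Latin and the knight
  condition.\<close>

lemma mod_neq_of_dist_less:
  fixes a b n :: nat
  assumes "a \<noteq> b" and "\<bar>int a - int b\<bar> < int n"
  shows "a mod n \<noteq> b mod n"
proof
  assume "a mod n = b mod n"
  then have "int n dvd int a - int b"
    by (metis mod_eq_dvd_iff zmod_int)
  with assms show False
    using zdvd_not_zless[of "\<bar>int a - int b\<bar>" "int n"] by auto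
qed

text \<open>An injective self-map of the finite set \<open>{1..n}\<close> is onto: injectivity gives
  uniqueness, surjectivity existence.\<close>

lemma cyclic_ex1:
  fixes i k n :: nat
  assumes "k \<in> {1..n}"
  shows "\<exists>!j. j \<in> {1..n} \<and> (i + j) mod n + 1 = k"
proof -
  let ?f = "\<lambda>j. (i + j) mod n + 1"
  have inj: "inj_on ?f {1..n}"
  proof (rule inj_onI, rule ccontr)
    fix j j' assume "j \<in> {1..n}" "j' \<in> {1..n}" and eq: "?f j = ?f j'" and "j \<noteq> j'"
    then have "i + j \<noteq> i + j'" "\<bar>int (i + j) - int (i + j')\<bar> < int n"
      unfolding atLeastAtMost_iff by linarith+
    from mod_neq_of_dist_less[OF this] eq show False
      by simp
  qed
  moreover have "?f ` {1..n} \<subseteq> {1..n}"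
    \<comment> \<open>The range of \<open>k\<close> forces \<open>n > 0\<close>, so residues mod
      \<open>n\<close> are below \<open>n\<close>.\<close>
    using assms by (auto simp: Suc_le_eq)
  ultimately have "?f ` {1..n} = {1..n}"
    by (simp add: endo_inj_surj)
  then have "k \<in> ?f ` {1..n}"
    using assms by (simp only:)
  then obtain j where j: "j \<in> {1..n}" "?f j = k"
    by (elim imageE) simp
  show ?thesis
  proof (intro ex1I[of _ j] conjI)
    fix j' assume "j' \<in> {1..n} \<and> ?f j' = k"
    then show "j' = j"
      using inj j by (metis (no_types, lifting) inj_onD)
  qed (fact j)+
qed

theorem theorem10:
  fixes n :: nat
  assumes "n > 3"
  shows "\<exists>L. anti_knight_latin_square n L"
proof -
  \<comment> \<open>The \<open>+ 1\<close> moves the residues 0 to \<open>n - 1\<close> onto the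
    symbols 1 to \<open>n\<close>.\<close>
  let ?L = "\<lambda>i j. (i + j) mod n + 1"
  \<comment> \<open>The table is symmetric, so the row property transposes to columns.\<close>
  have "\<exists>!i. i \<in> {1..n} \<and> ?L i j = k" if "k \<in> {1..n}" for j k
    using cyclic_ex1[OF that, of j] by (simp only: add.commute)
  moreover have "?L i j \<in> {1..n}" for i j
    using assms by (simp add: Suc_le_eq)
  ultimately have "latin_square n ?L"
    unfolding latin_square_def by (intro conjI ballI cyclic_ex1)
  moreover have "?L i j \<noteq> ?L i' j'" if "knight_move (i, j) (i', j')" for i j i' j'
  proof -
    have "i + j \<noteq> i' + j'" "\<bar>int (i + j) - int (i' + j')\<bar> \<le> 3"
      using that by (auto simp: knight_move_def)
    then show ?thesis
      using assms mod_neq_of_dist_less[of "i + j" "i' + j'" n] by simp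
  qed
  ultimately show ?thesis
    unfolding anti_knight_latin_square_def by blast
qed

end
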